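(* (Validity of the syllogisms of Figure II.) Let $S,M,P$ be three logically independent events. Then the following probabilistic inferences hold, where $\models_s$ denotes strict validity and $\models$ denotes validity: \begin{itemize} \item (Camestres) $(p(M|P)=1,\ p(M|S)=0,\ p(S|(S\vee P))>0)\ \models_s\ p(P|S)=0$; \item (Camestrop) $(p(M|P)=1,\ p(M|S)=0,\ p(S|(S\vee P))>0)\ \models\ p(\overline{P}|S)>0$, and this inference is not strictly valid; \item (Baroco) $(p(M|P)=1,\ p(\overline{M}|S)>0,\ p(S|(S\vee P))>0)\ \models_s\ p(\overline{P}|S)>0$; \item (Cesare) $(p(M|P)=0,\ p(M|S)=1,\ p(S|(S\vee P))>0)\ \models_s\ p(P|S)=0$; \item (Cesaro) $(p(M|P)=0,\ p(M|S)=1,\ p(S|(S\vee P))>0)\ \models\ p(\overline{P}|S)>0$, and this inference is not strictly valid; \item (Festino) $(p(M|P)=0,\ p(M|S)>0,\ p(S|(S\vee P))>0)\ \models_s\ p(\overline{P}|S)>0$. \end{itemize}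
   Context: Events are elements of a Boolean algebra (e.g. subsets of a set $\Omega$), identified with their $\{0,1\}$-valued indicators; $\overline{E}$ is the negation of $E$ and juxtaposition or $\wedge$ is conjunction. Three events are logically independent if all $8$ conjunctions obtained by choosing each of them or its negation are different from the impossible event $\bot$. For events $E,H$ with $H\ne\bot$, the conditional event $E|H$ is true if $EH$ is true, false if $\overline{E}H$ is true, and void if $H$ is false. Coherence: an assessment $\mathcal P=(p_1,\dots,p_n)\in\mathbb R^n$ on $\mathcal F=(E_1|H_1,\dots,E_n|H_n)$ is coherent if for every nonempty $J\subseteq\{1,\dots,n\}$ and all real numbers $s_j$ ($j\in J$), the random gain $G=\sum_{j\in J}s_jH_j(E_j-p_j)$, restricted to $\bigvee_{j\in J}H_j$ (i.e. considering only its values when at least one $H_j$, $j\in J$, is true), has minimum $\le 0$ and maximum $\ge 0$. An imprecise assessment on $\mathcal F$ is a set $\mathcal I\subseteq[0,1]^n$; it is g-coherent if it contains at least one coherent assessment. The set $\Sigma$ of coherent extensions of $\mathcal I$ to a further conditional event $E_{n+1}|H_{n+1}$ is the set of all $z\in[0,1]$ such that, for some coherent $\mathcal P\in\mathcal I$, the assessment $(\mathcal P,z)$ on $(\mathcal F,E_{n+1}|H_{n+1})$ is coherent. For a g-coherent $\mathcal I$ on $\mathcal F$ and a nonempty $\mathcal I'\subseteq[0,1]$, the inference "from $\mathcal I$ on $\mathcal F$ infer $\mathcal I'$ on $E_{n+1}|H_{n+1}$" is valid ($\models$) if $\Sigma\subseteq\mathcal I'$, and strictly valid ($\models_s$) if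 $\Sigma=\mathcal I'$. A list of constraints $p(E_i|H_i)\in\mathcal I_i$ stands for the imprecise assessment $\mathcal I_1\times\cdots\times\mathcal I_n$; all probabilities range in $[0,1]$, so "$=1$" is $\{1\}$, "$=0$" is $\{0\}$, and "$>0$" is $(0,1]$. A conclusion $p(\overline{P}|S)\in\mathcal I'$ is an assessment on $\overline{P}|S$. *)

theory Defs
  imports Complex_Main
begin

text \<open>Events are elements of an arbitrary Boolean algebra. A conditional event is a term
  \<open>E given H\<close>; the standing requirement \<open>H \<noteq> bot\<close> is imposed where assessments are defined.\<close>

datatype 'a cond_event = Given (event: 'a) (cond: 'a)  (infix \<open>given\<close> 60)

definition logically_independent :: "'a::boolean_algebra \<Rightarrow> 'a \<Rightarrow> 'a \<Rightarrow> bool" where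
  "logically_independent A B C \<longleftrightarrow>
     (\<forall>A' \<in> {A, - A}. \<forall>B' \<in> {B, - B}. \<forall>C' \<in> {C, - C}. inf A' (inf B' C') \<noteq> bot)"

text \<open>In an abstract Boolean algebra there are no sample points, so the joint values of the
  indicators of finitely many events are given by the constituents: a truth assignment \<open>v\<close> on the
  events \<open>Xs\<close> is possible iff the conjunction of the events that it makes true and the negations
  of those that it makes false is not the impossible event. In the algebra of all subsets of
  \<open>\<Omega>\<close> these are exactly the assignments induced by the points of \<open>\<Omega>\<close>.\<close>

definition possible :: "'a::boolean_algebra list \<Rightarrow> ('a \<Rightarrow> bool) \<Rightarrow> bool" where
  "possible Xs v \<longleftrightarrow> foldr inf (map (\<lambda>X. if v X then X else - X) Xs) top \<noteq> bot"

definition gain :: "'a cond_event list \<Rightarrow> real list \<Rightarrow> nat set \<Rightarrow> (nat \<Rightarrow> real) \<Rightarrow> ('a \<Rightarrow> bool) \<Rightarrow> real" where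
  "gain F p J s v =
     (\<Sum>j\<in>J. s j * of_bool (v (cond (F ! j))) * (of_bool (v (event (F ! j))) - p ! j))"

text \<open>The values of the gain when at least one conditioning event indexed by \<open>J\<close> is true.
  Using the truth assignments on all events of \<open>F\<close>, rather than only on those indexed
  by \<open>J\<close>, yields the same set of values.\<close>

definition gain_values ::
    "'a::boolean_algebra cond_event list \<Rightarrow> real list \<Rightarrow> nat set \<Rightarrow> (nat \<Rightarrow> real) \<Rightarrow> real set" where
  "gain_values F p J s =
     gain F p J s ` {v. possible (map event F @ map cond F) v \<and> (\<exists>j\<in>J. v (cond (F ! j)))}"

text \<open>The set of gain values is finite, and nonempty for nonempty \<open>J\<close> because the conditioning
  events are different from \<open>bot\<close>, so its minimum and maximum exist.\<close>

definition coherent :: "'a::boolean_algebra cond_event list \<Rightarrow> real list \<Rightarrow> bool" where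
  "coherent F p \<longleftrightarrow>
     length p = length F \<and> (\<forall>C \<in> set F. cond C \<noteq> bot) \<and>
     (\<forall>J s. J \<subseteq> {..<length F} \<and> J \<noteq> {} \<longrightarrow>
        Min (gain_values F p J s) \<le> 0 \<and> 0 \<le> Max (gain_values F p J s))"

definition imprecise_assessment :: "'a cond_event list \<Rightarrow> real list set \<Rightarrow> bool" where
  "imprecise_assessment F I \<longleftrightarrow> I \<subseteq> listset (replicate (length F) {0..1})"

definition g_coherent :: "'a::boolean_algebra cond_event list \<Rightarrow> real list set \<Rightarrow> bool" where
  "g_coherent F I \<longleftrightarrow> imprecise_assessment F I \<and> (\<exists>p\<in>I. coherent F p)"

definition coherent_extensions ::
    "'a::boolean_algebra cond_event list \<Rightarrow> real list set \<Rightarrow> 'a cond_event \<Rightarrow> real set" where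
  "coherent_extensions F I C =
     {z \<in> {0..1}. \<exists>p\<in>I. coherent F p \<and> coherent (F @ [C]) (p @ [z])}"

text \<open>Validity is only meaningful for an inference, i.e. for g-coherent premises and a nonempty
  conclusion set in the unit interval; this is made part of both notions of validity.\<close>

definition inference ::
    "'a::boolean_algebra cond_event list \<Rightarrow> real list set \<Rightarrow> 'a cond_event \<Rightarrow> real set \<Rightarrow> bool" where
  "inference F I C I' \<longleftrightarrow> g_coherent F I \<and> cond C \<noteq> bot \<and> I' \<noteq> {} \<and> I' \<subseteq> {0..1}"

definition valid ::
    "'a::boolean_algebra cond_event list \<Rightarrow> real list set \<Rightarrow> 'a cond_event \<Rightarrow> real set \<Rightarrow> bool" where
  "valid F I C I' \<longleftrightarrow> inference F I C I' \<and> coherent_extensions F I C \<subseteq> I'"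

definition strictly_valid ::
    "'a::boolean_algebra cond_event list \<Rightarrow> real list set \<Rightarrow> 'a cond_event \<Rightarrow> real set \<Rightarrow> bool" where
  "strictly_valid F I C I' \<longleftrightarrow> inference F I C I' \<and> coherent_extensions F I C = I'"

end

theory Submission
  imports Defs
begin

text \<open>
  Everything follows from one fact: let the premises be \<open>p(M|P) = 1\<close>, \<open>p(M|S) = u\<close> and
  \<open>p(S|S \<or> P) > 0\<close>. Then the coherent values of \<open>p(P|S)\<close> are exactly those in \<open>[0, u]\<close>.
  Intuitively, almost all of \<open>P\<close> lies in \<open>M\<close>; since \<open>S\<close> has positive probability given
  \<open>S \<or> P\<close>, this persists after conditioning on \<open>S\<close>, so that \<open>P \<and> S\<close> is no more probable
  given \<open>S\<close> than \<open>M \<and> S\<close>. If \<open>z = p(P|S) > u\<close>, this becomes an explicit sure loss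
  (\<open>coherent_figure_II_le\<close>). If \<open>z \<le> u\<close>, a probability with the required conditional values
  exists on four of the constituents, and with \<open>p(S|S \<or> P) = 1/2\<close> all conditioning events
  have positive probability (\<open>coherent_figure_II\<close>).

  With \<open>u = 0\<close> this is Camestres. With \<open>u\<close> ranging over \<open>[0, 1)\<close> it gives
  \<open>p(P|S) < 1\<close>, which is Baroco once \<open>M|S\<close> and \<open>P|S\<close> are read through their complements.
  Cesare and Festino are the same two inferences with \<open>- M\<close> in place of \<open>M\<close>. These
  translations rest on the invariance of coherence under replacing some \<open>E|H\<close> by \<open>- E|H\<close>
  and its value \<open>p\<close> by \<open>1 - p\<close>. Camestrop and Cesaro weaken the conclusion \<open>{1}\<close> for
  \<open>- P|S\<close> to \<open>(0, 1]\<close>, and therefore are valid but not strictly valid.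
\<close>

section \<open>Constituents as nonzero elements deciding all events\<close>

text \<open>A nonzero element that lies below each event or its complement plays the role of a sample
  point. In contrast to an arbitrary truth assignment, it treats \<open>E\<close> and \<open>- E\<close> consistently
  even when only one of them is listed, which the complementation argument relies on.\<close>

definition decides :: "'a::boolean_algebra \<Rightarrow> 'a cond_event list \<Rightarrow> bool" where
  "decides b F \<longleftrightarrow> (\<forall>X \<in> set (map event F @ map cond F). b \<le> X \<or> b \<le> - X)"

lemma le_foldr_inf_iff:
  fixes b :: "'a::boolean_algebra"
  shows "b \<le> foldr inf (map f Xs) top \<longleftrightarrow> (\<forall>X \<in> set Xs. b \<le> f X)"
  by (induction Xs) auto

lemma possible_iff:
  "possible Xs v \<longleftrightarrow> (\<exists>b. b \<noteq> bot \<and> (\<forall>X \<in> set Xs. b \<le> (if v X then X else - X)))"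
  unfolding possible_def le_foldr_inf_iff[symmetric]
  by (auto dest: le_bot)

lemma le_compl_iff:
  fixes b :: "'a::boolean_algebra"
  assumes "b \<noteq> bot" "b \<le> X \<or> b \<le> - X"
  shows "b \<le> - X \<longleftrightarrow> \<not> b \<le> X"
proof -
  have "b \<le> bot" if "b \<le> X" "b \<le> - X"
    using le_infI[OF that] by simp
  then show ?thesis using assms bot.extremum_uniqueI by blast
qed

lemma gain_cong:
  assumes "J \<subseteq> {..<length F}" "\<And>X. X \<in> set (map event F @ map cond F) \<Longrightarrow> v X = w X"
  shows "gain F p J s v = gain F p J s w"
  unfolding gain_def
  by (rule sum.cong) (use assms in \<open>auto simp: subset_iff\<close>)

lemma gain_values_eq:
  assumes J: "J \<subseteq> {..<length F}"
  shows "gain_values F p J s = (\<lambda>b. gain F p J s (\<lambda>X. b \<le> X)) `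
           {b. b \<noteq> bot \<and> decides b F \<and> (\<exists>j\<in>J. b \<le> cond (F ! j))}" (is "_ = ?g ` ?B")
proof
  let ?E = "map event F @ map cond F"
  show "gain_values F p J s \<subseteq> ?g ` ?B"
  proof
    fix g assume "g \<in> gain_values F p J s"
    then obtain v j where v: "possible ?E v" "g = gain F p J s v" "j \<in> J" "v (cond (F ! j))"
      unfolding gain_values_def by blast
    obtain b where b: "b \<noteq> bot" "\<And>X. X \<in> set ?E \<Longrightarrow> b \<le> (if v X then X else - X)"
      using v(1) unfolding possible_iff by blast
    have dec: "decides b F"
      unfolding decides_def using b(2) by (metis (full_types))
    have eq: "v X \<longleftrightarrow> b \<le> X" if "X \<in> set ?E" for X
      using b(2)[OF that] le_compl_iff[OF b(1), of X] by (auto split: if_splits)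
    have "cond (F ! j) \<in> set ?E"
      using v(3) J by auto
    then have "b \<in> ?B"
      using b(1) dec v(3,4) eq by blast
    moreover have "g = ?g b"
      unfolding v(2) by (rule gain_cong[OF J eq])
    ultimately show "g \<in> ?g ` ?B" by blast
  qed
  show "?g ` ?B \<subseteq> gain_values F p J s"
  proof clarify
    fix b j assume b: "b \<noteq> bot" "decides b F" "j \<in> J" "b \<le> cond (F ! j)"
    have "possible ?E (\<lambda>X. b \<le> X)"
      unfolding possible_iff using b(1,2) unfolding decides_def by (intro exI[of _ b]) auto
    then show "?g b \<in> gain_values F p J s"
      unfolding gain_values_def using b(3,4) by blast
  qed
qed

text \<open>The gain depends only on which of the finitely many listed events are true.\<close>

lemma finite_gain_values:
  assumes "J \<subseteq> {..<length F}"
  shows "finite (gain_values F p J s)"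
proof (rule finite_subset)
  let ?E = "set (map event F @ map cond F)"
  show "gain_values F p J s \<subseteq> (\<lambda>T. gain F p J s (\<lambda>X. X \<in> T)) ` Pow ?E"
  proof
    fix g assume "g \<in> gain_values F p J s"
    then obtain v where "g = gain F p J s v"
      unfolding gain_values_def by blast
    also have "\<dots> = gain F p J s (\<lambda>X. X \<in> {X \<in> ?E. v X})"
      by (rule gain_cong[OF assms]) simp
    finally show "g \<in> (\<lambda>T. gain F p J s (\<lambda>X. X \<in> T)) ` Pow ?E" by blast
  qed
qed simp

text \<open>The finite shadow of the ultrafilter theorem: cut \<open>a\<close> successively by each event or by its
  complement, at least one of which leaves something nonzero.\<close>

lemma ex_deciding_below:
  fixes a :: "'a::boolean_algebra"
  assumes "a \<noteq> bot"
  shows "\<exists>b. b \<noteq> bot \<and> b \<le> a \<and> (\<forall>X \<in> set Xs. b \<le> X \<or> b \<le> - X)"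
proof (induction Xs)
  case Nil
  show ?case using assms by auto
next
  case (Cons X Xs)
  then obtain b where b: "b \<noteq> bot" "b \<le> a" "\<forall>X \<in> set Xs. b \<le> X \<or> b \<le> - X" by blast
  have "sup (inf b X) (inf b (- X)) = b"
    by (simp add: inf_sup_distrib1[symmetric])
  then have "inf b X \<noteq> bot \<or> inf b (- X) \<noteq> bot"
    using b(1) by auto
  then obtain c where "c \<noteq> bot" "c \<le> b" "c \<le> X \<or> c \<le> - X"
    by (meson inf_le1 inf_le2)
  then show ?case
    using b(2,3) by (intro exI[of _ c]) (auto intro: order_trans)
qed

lemma gain_values_nonempty:
  assumes J: "J \<subseteq> {..<length F}" "J \<noteq> {}" and "\<forall>C \<in> set F. cond C \<noteq> bot"
  shows "gain_values F p J s \<noteq> {}"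
proof -
  obtain j where j: "j \<in> J" using J(2) by blast
  then have "cond (F ! j) \<noteq> bot" using assms by auto
  from ex_deciding_below[OF this] show ?thesis
    unfolding gain_values_eq[OF J(1)] decides_def using j by blast
qed

lemma gain_minus: "gain F p J (\<lambda>j. - s j) v = - gain F p J s v"
  unfolding gain_def by (simp add: sum_negf)

text \<open>Negating all stakes negates the gain and thereby exchanges the conditions on the minimum and
  on the maximum, so that the latter alone characterizes coherence.\<close>

lemma coherent_iff:
  "coherent F p \<longleftrightarrow> length p = length F \<and> (\<forall>C \<in> set F. cond C \<noteq> bot) \<and>
     (\<forall>J s. J \<subseteq> {..<length F} \<and> J \<noteq> {} \<longrightarrow>
        (\<exists>b. b \<noteq> bot \<and> decides b F \<and> (\<exists>j\<in>J. b \<le> cond (F ! j)) \<and>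
             0 \<le> gain F p J s (\<lambda>X. b \<le> X)))"
  (is "_ \<longleftrightarrow> ?len \<and> ?nz \<and> (\<forall>J s. ?J J \<longrightarrow> ?R J s)")
proof -
  have fin_ne: "finite (gain_values F p J s)" "gain_values F p J s \<noteq> {}" if "?J J" "?nz" for J s
    using that finite_gain_values gain_values_nonempty by blast+
  have Max: "0 \<le> Max (gain_values F p J s) \<longleftrightarrow> ?R J s" if "?J J" "?nz" for J s
    unfolding Max_ge_iff[OF fin_ne[OF that]]
    unfolding gain_values_eq[OF conjunct1[OF that(1)]] by blast
  have Min: "Min (gain_values F p J s) \<le> 0 \<longleftrightarrow> ?R J (\<lambda>j. - s j)" if "?J J" "?nz" for J s
    unfolding Min_le_iff[OF fin_ne[OF that]]
    unfolding gain_values_eq[OF conjunct1[OF that(1)]]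
      gain_minus neg_0_le_iff_le by blast
  show ?thesis
  proof (cases "?len \<and> ?nz")
    case True
    then have "coherent F p \<longleftrightarrow> (\<forall>J s. ?J J \<longrightarrow> ?R J (\<lambda>j. - s j) \<and> ?R J s)"
      unfolding coherent_def using Max Min by simp
    then show ?thesis using True by blast
  qed (auto simp: coherent_def)
qed

lemma coherent_butlast:
  assumes "coherent (F @ [C]) (p @ [z])"
  shows "coherent F p"
proof -
  have len: "length p = length F" and nz: "\<forall>C \<in> set F. cond C \<noteq> bot"
    using assms unfolding coherent_def by auto
  have "\<exists>b. b \<noteq> bot \<and> decides b F \<and> (\<exists>j\<in>J. b \<le> cond (F ! j)) \<and>
             0 \<le> gain F p J s (\<lambda>X. b \<le> X)"
    if J: "J \<subseteq> {..<length F}" "J \<noteq> {}" for J s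
  proof -
    have "J \<subseteq> {..<length (F @ [C])}" using J(1) by auto
    with assms J(2) obtain b j where b: "b \<noteq> bot" "decides b (F @ [C])" "j \<in> J"
      "b \<le> cond ((F @ [C]) ! j)" "0 \<le> gain (F @ [C]) (p @ [z]) J s (\<lambda>X. b \<le> X)"
      unfolding coherent_iff by blast
    have "gain (F @ [C]) (p @ [z]) J s (\<lambda>X. b \<le> X) = gain F p J s (\<lambda>X. b \<le> X)"
      unfolding gain_def by (rule sum.cong) (use J(1) len in \<open>auto simp: nth_append\<close>)
    moreover have "decides b F" using b(2) by (auto simp: decides_def)
    moreover have "b \<le> cond (F ! j)" using b(3,4) J(1) by (auto simp: nth_append subset_iff)
    ultimately show ?thesis using b by metis
  qed
  then show ?thesis unfolding coherent_iff using len nz by blast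
qed

text \<open>The easy half of the correspondence between coherence and conditional probability: under the
  weights \<open>w\<close> the expected gain vanishes for all stakes, hence the gain cannot be negative on all
  constituents at which some bet is active. Positive weight of every conditioning event
  excludes that these constituents carry no weight at all.\<close>

lemma coherent_if_weights:
  fixes w :: "'k \<Rightarrow> real" and B :: "'k \<Rightarrow> 'a::boolean_algebra"
  assumes len: "length p = length F"
    and K: "finite K" "\<And>k. k \<in> K \<Longrightarrow> 0 \<le> w k"
    and B: "\<And>k. k \<in> K \<Longrightarrow> B k \<noteq> bot" "\<And>k. k \<in> K \<Longrightarrow> decides (B k) F"
    and pos: "\<And>i. i < length F \<Longrightarrow> \<exists>k\<in>K. 0 < w k \<and> B k \<le> cond (F ! i)"
    and fair: "\<And>i. i < length F \<Longrightarrow> (\<Sum>k\<in>K. w k * of_bool (B k \<le> cond (F ! i)) *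
                   (of_bool (B k \<le> event (F ! i)) - p ! i)) = 0"
  shows "coherent F p"
proof -
  have nz: "cond C \<noteq> bot" if "C \<in> set F" for C
  proof -
    obtain i where "i < length F" "F ! i = C" using \<open>C \<in> set F\<close> by (auto simp: in_set_conv_nth)
    then obtain k where "k \<in> K" "B k \<le> cond C" using pos by blast
    then show ?thesis using B(1) le_bot by metis
  qed
  have "\<exists>b. b \<noteq> bot \<and> decides b F \<and> (\<exists>j\<in>J. b \<le> cond (F ! j)) \<and>
             0 \<le> gain F p J s (\<lambda>X. b \<le> X)"
    if J: "J \<subseteq> {..<length F}" "J \<noteq> {}" for J s
  proof (rule ccontr)
    let ?g = "\<lambda>k. gain F p J s (\<lambda>X. B k \<le> X)"
    assume no: "\<not> ?thesis"
    have neg: "?g k < 0" if "k \<in> K" "\<exists>j\<in>J. B k \<le> cond (F ! j)" for k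
      using no B[OF that(1)] that(2) not_le by blast
    have zero: "?g k = 0" if "\<not> (\<exists>j\<in>J. B k \<le> cond (F ! j))" for k
      unfolding gain_def using that by (intro sum.neutral) auto
    have le: "w k * ?g k \<le> 0" if "k \<in> K" for k
    proof (cases "\<exists>j\<in>J. B k \<le> cond (F ! j)")
      case True
      then show ?thesis using neg[OF that True] K(2)[OF that] by (simp add: mult_nonneg_nonpos)
    qed (simp add: zero)
    obtain j where j: "j \<in> J" "j < length F" using J by blast
    then obtain k where k: "k \<in> K" "0 < w k" "B k \<le> cond (F ! j)" using pos by blast
    then have "w k * ?g k < 0" using neg[OF k(1)] j(1) by (intro mult_pos_neg) blast+
    then have "(\<Sum>k\<in>K. w k * ?g k) < (\<Sum>k\<in>K. 0)"
      using K(1) k(1) le by (intro sum_strict_mono_ex1) auto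
    moreover have "(\<Sum>k\<in>K. w k * ?g k) = (\<Sum>j\<in>J. s j * (\<Sum>k\<in>K. w k *
        of_bool (B k \<le> cond (F ! j)) * (of_bool (B k \<le> event (F ! j)) - p ! j)))"
      unfolding gain_def sum_distrib_left by (subst sum.swap) (simp add: mult_ac)
    moreover have "\<dots> = 0"
      using J(1) fair by (intro sum.neutral) auto
    ultimately show False by simp
  qed
  then show ?thesis unfolding coherent_iff using len nz by blast
qed

section \<open>Complementing an event\<close>

definition compl_at :: "nat \<Rightarrow> 'a::boolean_algebra cond_event list \<Rightarrow> 'a cond_event list" where
  "compl_at i F = F[i := - event (F ! i) given cond (F ! i)]"

definition flip_at :: "nat \<Rightarrow> real list \<Rightarrow> real list" where
  "flip_at i p = p[i := 1 - p ! i]"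

lemma length_compl_at [simp]: "length (compl_at i F) = length F"
  by (simp add: compl_at_def)

lemma length_flip_at [simp]: "length (flip_at i p) = length p"
  by (simp add: flip_at_def)

lemma compl_at_compl_at [simp]: "compl_at i (compl_at i F) = F"
  by (cases "i < length F") (simp_all add: compl_at_def list_update_beyond)

lemma flip_at_flip_at [simp]: "flip_at i (flip_at i p) = p"
  by (cases "i < length p") (simp_all add: flip_at_def list_update_beyond)

lemma cond_compl_at [simp]: "j < length F \<Longrightarrow> cond (compl_at i F ! j) = cond (F ! j)"
  by (cases "i = j") (simp_all add: compl_at_def)

lemma event_compl_at:
  "j < length F \<Longrightarrow> event (compl_at i F ! j) = (if i = j then - event (F ! j) else event (F ! j))"
  by (cases "i = j") (simp_all add: compl_at_def)

lemma decides_nth: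
  "decides b F \<longleftrightarrow> (\<forall>j<length F. (b \<le> event (F ! j) \<or> b \<le> - event (F ! j)) \<and>
                                  (b \<le> cond (F ! j) \<or> b \<le> - cond (F ! j)))"
  unfolding decides_def set_append set_map ball_Un ball_simps(9) all_set_conv_all_nth by blast

lemma decides_compl_at [simp]: "decides b (compl_at i F) \<longleftrightarrow> decides b F"
proof -
  have "(b \<le> event (compl_at i F ! j) \<or> b \<le> - event (compl_at i F ! j)) \<longleftrightarrow>
        (b \<le> event (F ! j) \<or> b \<le> - event (F ! j))" if "j < length F" for j
    using that by (cases "i = j") (simp_all add: event_compl_at disj_commute)
  then show ?thesis by (simp add: decides_nth)
qed

text \<open>Betting on \<open>- E|H\<close> at price \<open>1 - p\<close> is the same as betting against \<open>E|H\<close> at price \<open>p\<close>.\<close>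

lemma gain_compl_at:
  assumes "b \<noteq> bot" "decides b F" "J \<subseteq> {..<length F}" "length p = length F"
  shows "gain (compl_at i F) (flip_at i p) J s (\<lambda>X. b \<le> X) =
         gain F p J (s(i := - s i)) (\<lambda>X. b \<le> X)"
  unfolding gain_def
proof (rule sum.cong)
  fix j assume "j \<in> J"
  then have j: "j < length F" using assms(3) by auto
  then have "b \<le> - event (F ! j) \<longleftrightarrow> \<not> b \<le> event (F ! j)"
    using le_compl_iff[OF assms(1)] assms(2) by (simp add: decides_nth)
  then show "s j * of_bool (b \<le> cond (compl_at i F ! j)) *
      (of_bool (b \<le> event (compl_at i F ! j)) - flip_at i p ! j) =
    (s(i := - s i)) j * of_bool (b \<le> cond (F ! j)) * (of_bool (b \<le> event (F ! j)) - p ! j)"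
    using j assms(4) by (auto simp: event_compl_at flip_at_def algebra_simps)
qed simp

lemma coherent_compl_at_imp:
  assumes "coherent F p"
  shows "coherent (compl_at i F) (flip_at i p)"
proof -
  have len: "length p = length F" and nz: "\<And>C. C \<in> set F \<Longrightarrow> cond C \<noteq> bot"
    using assms unfolding coherent_def by auto
  have "\<forall>C \<in> set (compl_at i F). cond C \<noteq> bot"
    using nz by (simp add: all_set_conv_all_nth)
  moreover have "\<exists>b. b \<noteq> bot \<and> decides b (compl_at i F) \<and>
      (\<exists>j\<in>J. b \<le> cond (compl_at i F ! j)) \<and>
      0 \<le> gain (compl_at i F) (flip_at i p) J s (\<lambda>X. b \<le> X)"
    if J: "J \<subseteq> {..<length F}" "J \<noteq> {}" for J s
  proof -
    obtain b j where b: "b \<noteq> bot" "decides b F" "j \<in> J" "b \<le> cond (F ! j)"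
      "0 \<le> gain F p J (s(i := - s i)) (\<lambda>X. b \<le> X)"
      using assms J unfolding coherent_iff by blast
    have "b \<le> cond (compl_at i F ! j)"
      using b(3,4) J(1) by (auto simp: subset_iff)
    then show ?thesis
      using b(1-3,5) gain_compl_at[OF b(1,2) J(1) len]
      by (intro exI[of _ b] conjI bexI[of _ j]) simp_all
  qed
  ultimately show ?thesis unfolding coherent_iff using len by simp
qed

lemma coherent_compl_at [simp]: "coherent (compl_at i F) (flip_at i p) \<longleftrightarrow> coherent F p"
  using coherent_compl_at_imp[of F p i] coherent_compl_at_imp[of "compl_at i F" "flip_at i p" i]
  by auto

lemma compl_at_append: "i < length F \<Longrightarrow> compl_at i (F @ [C]) = compl_at i F @ [C]"
  by (simp add: compl_at_def nth_append list_update_append)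

lemma flip_at_append: "i < length p \<Longrightarrow> flip_at i (p @ [z]) = flip_at i p @ [z]"
  by (simp add: flip_at_def nth_append list_update_append)

lemma coherent_length: "coherent F p \<Longrightarrow> length p = length F"
  by (simp add: coherent_def)

lemma coherent_extensions_iff:
  "z \<in> coherent_extensions F I C \<longleftrightarrow> z \<in> {0..1} \<and> (\<exists>p\<in>I. coherent (F @ [C]) (p @ [z]))"
  unfolding coherent_extensions_def using coherent_butlast by blast

lemma coherent_extensions_compl_premise:
  assumes "i < length F"
  shows "coherent_extensions (compl_at i F) (flip_at i ` I) C = coherent_extensions F I C"
proof -
  have "coherent (compl_at i F @ [C]) (flip_at i p @ [z]) \<longleftrightarrow> coherent (F @ [C]) (p @ [z])" for p z
  proof (cases "length p = length F")
    case True
    then show ?thesis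
      using assms coherent_compl_at[of i "F @ [C]" "p @ [z]"]
      by (simp add: compl_at_append flip_at_append)
  qed (auto dest: coherent_length)
  then show ?thesis by (auto simp: coherent_extensions_iff)
qed

lemma coherent_extensions_compl_conclusion:
  "coherent_extensions F I (- E given H) = (\<lambda>z. 1 - z) ` coherent_extensions F I (E given H)"
proof -
  have "coherent (F @ [- E given H]) (p @ [1 - z]) \<longleftrightarrow> coherent (F @ [E given H]) (p @ [z])" for p z
  proof (cases "length p = length F")
    case True
    then show ?thesis
      using coherent_compl_at[of "length F" "F @ [E given H]" "p @ [z]"]
      by (simp add: compl_at_def flip_at_def nth_append list_update_append)
  qed (auto dest: coherent_length)
  note * = this
  have "z \<in> coherent_extensions F I (- E given H) \<longleftrightarrow> 1 - z \<in> coherent_extensions F I (E given H)" for z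
    using *[of _ "1 - z"] by (auto simp: coherent_extensions_iff)
  then show ?thesis by force
qed

lemma imprecise_assessment_iff:
  "imprecise_assessment F I \<longleftrightarrow> (\<forall>p\<in>I. length p = length F \<and> (\<forall>i<length F. p ! i \<in> {0..1}))"
proof -
  have "p \<in> listset (replicate n A) \<longleftrightarrow> length p = n \<and> (\<forall>i<n. p ! i \<in> A)" for p n and A :: "real set"
    by (induction n arbitrary: p) (auto simp: set_Cons_def length_Suc_conv All_less_Suc2)
  then show ?thesis by (auto simp: imprecise_assessment_def)
qed

lemma strictly_valid_compl_premise:
  assumes "strictly_valid F I C I'" "i < length F"
  shows "strictly_valid (compl_at i F) (flip_at i ` I) C I'"
proof -
  have "imprecise_assessment (compl_at i F) (flip_at i ` I)"
    using assms unfolding strictly_valid_def inference_def g_coherent_def imprecise_assessment_iff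
    by (auto simp: flip_at_def nth_list_update)
  then show ?thesis
    using assms coherent_extensions_compl_premise[OF assms(2)]
    unfolding strictly_valid_def inference_def g_coherent_def by auto
qed

lemma strictly_valid_compl_conclusion:
  assumes "strictly_valid F I (E given H) I'"
  shows "strictly_valid F I (- E given H) ((\<lambda>z. 1 - z) ` I')"
  using assms coherent_extensions_compl_conclusion[of F I E H]
  unfolding strictly_valid_def inference_def by auto

lemma strictly_valid_weaken:
  assumes "strictly_valid F I C A" "A \<subset> A'" "A' \<subseteq> {0..1}"
  shows "valid F I C A'" "\<not> strictly_valid F I C A'"
  using assms unfolding strictly_valid_def valid_def inference_def by auto

section \<open>Syllogisms of Figure II\<close>

text \<open>The sure loss for \<open>u < z\<close>: buy \<open>c\<close> units of \<open>P|S\<close>, sell \<open>c\<close> units of \<open>M|S\<close>, and buy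
  \<open>M|P\<close> in order to cover the case that \<open>P\<close> is true without \<open>M\<close>. At \<open>S\<close> with \<open>M\<close> and \<open>P\<close>
  both true or both false this loses \<open>c * (z - u)\<close>. One unit of \<open>S|(S \<or> P)\<close> is what makes
  the gain negative off \<open>S\<close>; there it yields \<open>- x\<close>, which is why \<open>x > 0\<close> is needed.\<close>

lemma coherent_figure_II_le:
  fixes S M P :: "'a::boolean_algebra"
  assumes coh: "coherent [M given P, M given S, S given sup S P, P given S] [1, u, x, z]"
    and x: "0 < x" "x \<le> 1"
  shows "z \<le> u"
proof (rule ccontr)
  assume "\<not> z \<le> u"
  then have zu: "0 < z - u" by simp
  \<comment> \<open>the loss \<open>c * (z - u)\<close> on \<open>S\<close> has to exceed the gain \<open>1 - x\<close> from \<open>S|(S \<or> P)\<close>\<close>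
  define c where "c = (2 - x) / (z - u)"
  have c: "0 < c" "c * (z - u) = 2 - x"
    using zu x(2) by (simp_all add: c_def)
  define s where "s = (!) [c + 1, - c, 1, c]"
  let ?F = "[M given P, M given S, S given sup S P, P given S]"
  have "{0,1,2,3} \<subseteq> {..<length ?F} \<and> {0,1,2,3} \<noteq> ({}::nat set)" by auto
  then obtain b where b: "b \<noteq> bot" "decides b ?F" "\<exists>j\<in>{0,1,2,3::nat}. b \<le> cond (?F ! j)"
    "0 \<le> gain ?F [1, u, x, z] {0,1,2,3} s (\<lambda>X. b \<le> X)"
    using coh unfolding coherent_iff by blast
  have sup: "b \<le> sup S P \<longleftrightarrow> b \<le> S \<or> b \<le> P"
  proof
    assume le: "b \<le> sup S P"
    show "b \<le> S \<or> b \<le> P"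
    proof (rule ccontr)
      assume "\<not> (b \<le> S \<or> b \<le> P)"
      then have "b \<le> - sup S P" using b(2) by (simp add: decides_def)
      then show False using le le_compl_iff[of b "sup S P"] b(1) by blast
    qed
  qed (auto intro: le_supI1 le_supI2)
  have "b \<le> S \<or> b \<le> P" using b(3) sup by auto
  moreover have "0 \<le> (c + 1) * of_bool (b \<le> P) * (of_bool (b \<le> M) - 1)
      - c * of_bool (b \<le> S) * (of_bool (b \<le> M) - u)
      + of_bool (b \<le> sup S P) * (of_bool (b \<le> S) - x)
      + c * of_bool (b \<le> S) * (of_bool (b \<le> P) - z)"
    using b(4) by (simp add: gain_def s_def algebra_simps)
  ultimately show False
    using c x sup by (auto simp: algebra_simps of_bool_def split: if_splits)
qed

text \<open>Give the constituents \<open>S M P\<close>, \<open>S M (- P)\<close>, \<open>S (- M) (- P)\<close> the weights \<open>z\<close>, \<open>u - z\<close>,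
  \<open>1 - u\<close>, so that \<open>S\<close> has total weight 1, and give weight 1 to \<open>(- S) M P\<close>. The
  last constituent makes the weight of \<open>P\<close> positive even for \<open>z = 0\<close>; it leads to the value
  \<open>1 / 2\<close> for \<open>S|(S \<or> P)\<close>.\<close>

lemma coherent_figure_II:
  fixes S M P :: "'a::boolean_algebra"
  assumes ind: "logically_independent S M P"
    and zu: "0 \<le> z" "z \<le> u" "u \<le> 1"
  shows "coherent [M given P, M given S, S given sup S P, P given S] [1, u, 1 / 2, z]"
    (is "coherent ?F ?p")
proof -
  have atom: "\<exists>b. b \<noteq> bot \<and> b \<le> S' \<and> b \<le> M' \<and> b \<le> P'"
    if "S' \<in> {S, - S}" "M' \<in> {M, - M}" "P' \<in> {P, - P}" for S' M' P'
    using ind that unfolding logically_independent_def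
    by (intro exI[of _ "inf S' (inf M' P')"]) (auto simp: le_infI1 le_infI2)
  obtain b0 where b0: "b0 \<noteq> bot" "b0 \<le> S" "b0 \<le> M" "b0 \<le> P"
    using atom[of S M P] by blast
  obtain b1 where b1: "b1 \<noteq> bot" "b1 \<le> S" "b1 \<le> M" "b1 \<le> - P"
    using atom[of S M "- P"] by blast
  obtain b2 where b2: "b2 \<noteq> bot" "b2 \<le> S" "b2 \<le> - M" "b2 \<le> - P"
    using atom[of S "- M" "- P"] by blast
  obtain b3 where b3: "b3 \<noteq> bot" "b3 \<le> - S" "b3 \<le> M" "b3 \<le> P"
    using atom[of "- S" M P] by blast
  have down: "\<not> b1 \<le> P" "\<not> b2 \<le> M" "\<not> b2 \<le> P" "\<not> b3 \<le> S"
    using le_compl_iff b1(1,4) b2(1,3,4) b3(1,2) by blast+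
  have sup: "b0 \<le> sup S P" "b1 \<le> sup S P" "b2 \<le> sup S P" "b3 \<le> sup S P"
    using b0 b1 b2 b3 by (simp_all add: le_supI1 le_supI2)
  define B where "B = (!) [b0, b1, b2, b3]"
  define w where "w = (!) [z, u - z, 1 - u, 1]"
  have B: "B 0 = b0" "B 1 = b1" "B (Suc 0) = b1" "B 2 = b2" "B 3 = b3" by (simp_all add: B_def)
  have w: "w 0 = z" "w 1 = u - z" "w (Suc 0) = u - z" "w 2 = 1 - u" "w 3 = 1" by (simp_all add: w_def)
  note val = B w b0 b1 b2 b3 down sup
  show ?thesis
  proof (rule coherent_if_weights[where K = "{0,1,2,3}" and w = w and B = B])
    fix k :: nat assume "k \<in> {0,1,2,3}"
    then consider "k = 0" | "k = 1" | "k = 2" | "k = 3" by blast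
    note k = this
    show "0 \<le> w k" by (cases rule: k) (use zu in \<open>simp_all add: w\<close>)
    show "B k \<noteq> bot" by (cases rule: k) (simp_all add: val)
    show "decides (B k) ?F" by (cases rule: k) (simp_all add: val decides_def)
  next
    have "0 < z \<or> 0 < u - z \<or> 0 < 1 - u" using zu by linarith
    then have pos: "\<exists>k\<in>{0,1,2,3}. 0 < w k \<and> B k \<le> S"
      by (auto simp: val)
    fix i assume "i < length ?F"
    then consider "i = 0" | "i = 1" | "i = 2" | "i = 3" by fastforce
    note i = this
    show "(\<Sum>k\<in>{0,1,2,3}. w k * of_bool (B k \<le> cond (?F ! i)) *
                   (of_bool (B k \<le> event (?F ! i)) - ?p ! i)) = 0"
      by (cases rule: i) (simp_all add: val field_simps)
    show "\<exists>k\<in>{0,1,2,3}. 0 < w k \<and> B k \<le> cond (?F ! i)"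
      by (cases rule: i) (use pos in \<open>simp_all add: val\<close>)
  qed simp_all
qed

lemma listset3: "listset [A, B, C] = (\<Union>a\<in>A. \<Union>b\<in>B. \<Union>c\<in>C. {[a, b, c]})"
  by (auto simp: set_Cons_def)

lemma mem_listset3: "p \<in> listset [A, B, C] \<longleftrightarrow> (\<exists>a\<in>A. \<exists>b\<in>B. \<exists>c\<in>C. p = [a, b, c])"
  by (auto simp: set_Cons_def)

text \<open>The common source of all six inferences: \<open>U\<close> is left open, to be taken as \<open>{0}\<close> or as
  \<open>[0, 1)\<close>.\<close>

lemma strictly_valid_figure_II:
  fixes S M P :: "'a::boolean_algebra"
  assumes ind: "logically_independent S M P" and U: "U \<noteq> {}" "U \<subseteq> {0..1}"
  shows "strictly_valid [M given P, M given S, S given sup S P] (listset [{1}, U, {0<..1}])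
           (P given S) {z. 0 \<le> z \<and> (\<exists>u\<in>U. z \<le> u)}"
    (is "strictly_valid ?F ?I ?C ?Z")
proof -
  have ext: "coherent_extensions ?F ?I ?C = ?Z"
  proof (intro set_eqI iffI)
    fix z assume "z \<in> coherent_extensions ?F ?I ?C"
    then obtain u x where "0 \<le> z" "u \<in> U" "0 < x" "x \<le> 1" "coherent (?F @ [?C]) [1, u, x, z]"
      by (auto simp: coherent_extensions_iff mem_listset3 simp del: listset.simps)
    then show "z \<in> ?Z" using coherent_figure_II_le[of M P S u x z] by auto
  next
    fix z assume "z \<in> ?Z"
    then obtain u where u: "0 \<le> z" "z \<le> u" "u \<in> U" by auto
    then have "u \<le> 1" using U(2) by auto
    then have "coherent (?F @ [?C]) ([1, u, 1 / 2] @ [z])"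
      using coherent_figure_II[OF ind u(1,2)] by simp
    moreover have "[1, u, 1 / 2] \<in> ?I"
      unfolding mem_listset3 using u(3) by (intro bexI[of _ 1] bexI[of _ u] bexI[of _ "1 / 2"]) auto
    ultimately show "z \<in> coherent_extensions ?F ?I ?C"
      unfolding coherent_extensions_iff using u(1,2) \<open>u \<le> 1\<close> by (meson atLeastAtMost_iff order_trans)
  qed
  have Z: "?Z \<noteq> {}" "?Z \<subseteq> {0..1}" using U by force+
  then obtain p where "p \<in> ?I" "coherent ?F p"
    unfolding ext[symmetric] coherent_extensions_def by blast
  moreover have "imprecise_assessment ?F ?I"
    using subsetD[OF U(2)]
    by (auto simp: imprecise_assessment_iff mem_listset3 less_Suc_eq simp del: listset.simps)
  moreover have "S \<noteq> bot" using ind by (auto simp: logically_independent_def)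
  ultimately show ?thesis
    using ext Z unfolding strictly_valid_def inference_def g_coherent_def by auto
qed

lemma logically_independent_compl2:
  "logically_independent S M P \<Longrightarrow> logically_independent S (- M) P"
  by (auto simp: logically_independent_def)

lemma image_flip_at_listset3:
  "flip_at 0 ` listset [A, B, C] = listset [(\<lambda>a. 1 - a) ` A, B, C]"
  "flip_at (Suc 0) ` listset [A, B, C] = listset [A, (\<lambda>b. 1 - b) ` B, C]"
  unfolding listset3 image_UN by (simp_all add: flip_at_def)

lemma image_one_minus:
  "(\<lambda>x. 1 - x) ` {0 :: real} = {1}" "(\<lambda>x. 1 - x) ` {1 :: real} = {0}"
  "(\<lambda>x. 1 - x) ` {0..<1 :: real} = {0<..1}"
  by auto

lemma camestres:
  fixes S M P :: "'a::boolean_algebra"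
  assumes "logically_independent S M P"
  shows "strictly_valid [M given P, M given S, S given sup S P] (listset [{1}, {0}, {0<..1}])
           (P given S) {0}"
proof -
  have "{z::real. 0 \<le> z \<and> (\<exists>u\<in>{0}. z \<le> u)} = {0}" by auto
  then show ?thesis using strictly_valid_figure_II[OF assms, of "{0}"] by simp
qed

text \<open>Baroco with its second premise \<open>p(- M|S) > 0\<close> expressed as \<open>p(M|S) < 1\<close>. This form, taken
  with \<open>- M\<close> for \<open>M\<close>, is also what Festino is obtained from.\<close>

lemma baroco_unnegated_middle:
  fixes S M P :: "'a::boolean_algebra"
  assumes "logically_independent S M P"
  shows "strictly_valid [M given P, M given S, S given sup S P] (listset [{1}, {0..<1}, {0<..1}])
           (- P given S) {0<..1}"
proof -
  have "{z::real. 0 \<le> z \<and> (\<exists>u\<in>{0..<1}. z \<le> u)} = {0..<1}" by force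
  then have "strictly_valid [M given P, M given S, S given sup S P]
      (listset [{1}, {0..<1}, {0<..1}]) (P given S) {0..<1}"
    using strictly_valid_figure_II[OF assms, of "{0..<1}"] by (simp add: subset_iff)
  from strictly_valid_compl_conclusion[OF this] show ?thesis
    by (simp only: image_one_minus)
qed

lemma baroco:
  fixes S M P :: "'a::boolean_algebra"
  assumes "logically_independent S M P"
  shows "strictly_valid [M given P, - M given S, S given sup S P]
           (listset [{1}, {0<..1}, {0<..1}]) (- P given S) {0<..1}"
  using strictly_valid_compl_premise[OF baroco_unnegated_middle[OF assms], of 1]
  by (simp add: compl_at_def image_flip_at_listset3 image_one_minus del: listset.simps)

lemma cesare:
  fixes S M P :: "'a::boolean_algebra"
  assumes "logically_independent S M P"
  shows "strictly_valid [M given P, M given S, S given sup S P] (listset [{0}, {1}, {0<..1}])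
           (P given S) {0}"
  using strictly_valid_compl_premise[OF strictly_valid_compl_premise[OF
      camestres[OF logically_independent_compl2[OF assms]], of 1], of 0]
  by (simp add: compl_at_def image_flip_at_listset3 image_one_minus del: listset.simps)

lemma festino:
  fixes S M P :: "'a::boolean_algebra"
  assumes "logically_independent S M P"
  shows "strictly_valid [M given P, M given S, S given sup S P] (listset [{0}, {0<..1}, {0<..1}])
           (- P given S) {0<..1}"
  using strictly_valid_compl_premise[OF strictly_valid_compl_premise[OF
      baroco_unnegated_middle[OF logically_independent_compl2[OF assms]], of 1], of 0]
  by (simp add: compl_at_def image_flip_at_listset3 image_one_minus del: listset.simps)

theorem mainTheorem6:
  fixes S M P :: "'a::boolean_algebra"
  assumes "logically_independent S M P"
  shows
    "strictly_valid
      [M given P, M given S, S given sup S P] (listset [{1}, {0}, {0<..1}])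
      (P given S) {0}
     \<and> valid
      [M given P, M given S, S given sup S P] (listset [{1}, {0}, {0<..1}])
      (- P given S) {0<..1}
     \<and> \<not> strictly_valid
      [M given P, M given S, S given sup S P] (listset [{1}, {0}, {0<..1}])
      (- P given S) {0<..1}
     \<and> strictly_valid
      [M given P, - M given S, S given sup S P] (listset [{1}, {0<..1}, {0<..1}])
      (- P given S) {0<..1}
     \<and> strictly_valid
      [M given P, M given S, S given sup S P] (listset [{0}, {1}, {0<..1}])
      (P given S) {0}
     \<and> valid
      [M given P, M given S, S given sup S P] (listset [{0}, {1}, {0<..1}])
      (- P given S) {0<..1}
     \<and> \<not> strictly_valid
      [M given P, M given S, S given sup S P] (listset [{0}, {1}, {0<..1}])
      (- P given S) {0<..1}
     \<and> strictly_valid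
      [M given P, M given S, S given sup S P] (listset [{0}, {0<..1}, {0<..1}])
      (- P given S) {0<..1}"
proof -
  have compl: "strictly_valid F I (- P given S) {1}" if "strictly_valid F I (P given S) {0}"
    for F :: "'a cond_event list" and I
    using strictly_valid_compl_conclusion[OF that] by (simp only: image_one_minus)
  have sub: "{1} \<subset> {0<..1::real}" "{0<..1} \<subseteq> {0..1::real}"
    by (auto simp: psubset_eq set_eq_iff intro!: exI[of _ "1 / 2"])
  show ?thesis
    using camestres[OF assms] strictly_valid_weaken[OF compl[OF camestres[OF assms]] sub]
      baroco[OF assms] cesare[OF assms]
      strictly_valid_weaken[OF compl[OF cesare[OF assms]] sub] festino[OF assms]
    by blast
qed

end
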